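(* Let $\mathcal{L}$ be a finite distributive lattice, let $\sigma$ be the cone associated to the Hibi toric variety $X_{\mathcal{L}}$, and let $S_\sigma=\sigma^\vee\cap M$. Then the semigroup $S_\sigma$ is generated by $\{f_A : A\in\mathcal{I}(J_{\mathcal{L}})\}$.
   Context: $K$ is an algebraically closed field of arbitrary characteristic. $\mathcal{L}$ is a finite distributive lattice with join $\vee$ and meet $\wedge$. $J_{\mathcal{L}}$ is the poset (with induced order) of join-irreducible elements, i.e. those $z\in\mathcal{L}$ such that $z=x\vee y$ implies $z=x$ or $z=y$ (so the minimal element $\hat 0$ belongs to $J_{\mathcal{L}}$). An ideal of $J_{\mathcal{L}}$ is a subset $A$ such that $x\in A$, $y\le x$ imply $y\in A$; $\mathcal{I}(J_{\mathcal{L}})$ is the set of (nonempty) ideals of $J_{\mathcal{L}}$, in bijection with $\mathcal{L}$ by $\alpha\mapsto I_\alpha=\{\theta\in J_{\mathcal{L}} : \theta\le\alpha\}$. The Hibi toric variety $X_{\mathcal{L}}\subset\mathbb{A}^{\#\mathcal{L}}$ is the affine variety whose vanishing ideal in $K[X_\alpha,\alpha\in\mathcal{L}]$ is the (prime) ideal generated by all $X_\alpha X_\beta-X_{\alpha\vee\beta}X_{\alpha\wedge\beta}$, $\alpha,\beta\in\mathcal{L}$. Let $T=(K^* )^{J_{\mathcal{L}}}$, $M=X(T)$ its character group with $\mathbb{Z}$-basis the coordinate characters $f_z$, $z\in J_{\mathcal{L}}$, and $N$ the $\mathbb{Z}$-dual of $M$. For $A\in\mathcal{I}(J_{\mathcal{L}})$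 put $f_A=\sum_{z\in A}f_z$. The map $t\mapsto (f_{I_\alpha}(t))_{\alpha\in\mathcal{L}}$ embeds $T$ as a dense open subset of $X_{\mathcal{L}}$ and makes $X_{\mathcal{L}}$ a normal affine toric variety; $\sigma\subset N\otimes\mathbb{R}$ is the strongly convex rational polyhedral cone such that $K[X_{\mathcal{L}}]$ (viewed inside $K[T]=K[M]$) equals the semigroup algebra $K[S_\sigma]$. Semigroups contain $0$, and "generated" means every element is a (possibly empty) sum of generators, i.e. a $\mathbb{Z}_{\ge0}$-linear combination. *)

theory Defs
  imports
    "HOL-Analysis.Analysis"
    "HOL-Computational_Algebra.Polynomial"
    "HOL-Library.Poly_Mapping"
begin

section \<open>Join-irreducibles of a finite distributive lattice\<close>

text \<open>A nonempty finite distributive lattice is a type of sort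
  \<open>{finite, distrib_lattice}\<close>.  With the definition below its least element is
  join-irreducible.\<close>

definition join_irreducible :: "'a::lattice \<Rightarrow> bool" where
  "join_irreducible z \<longleftrightarrow> (\<forall>x y. z = sup x y \<longrightarrow> z = x \<or> z = y)"

typedef (overloaded) 'a joinirr = "{z :: 'a::{finite, distrib_lattice}. join_irreducible z}"
proof
  define b :: 'a where "b = Inf_fin UNIV"
  have "sup x y = x" if "b = sup x y" for x y
    using that by (metis Inf_fin.coboundedI UNIV_I antisym b_def finite sup_ge1)
  then show "b \<in> {z :: 'a. join_irreducible z}"
    by (simp add: join_irreducible_def)
qed

instantiation joinirr :: ("{finite, distrib_lattice}") order
begin

definition less_eq_joinirr :: "'a joinirr \<Rightarrow> 'a joinirr \<Rightarrow> bool" where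
  "x \<le> y \<longleftrightarrow> Rep_joinirr x \<le> Rep_joinirr y"

definition less_joinirr :: "'a joinirr \<Rightarrow> 'a joinirr \<Rightarrow> bool" where
  "x < y \<longleftrightarrow> Rep_joinirr x < Rep_joinirr y"

instance
  by standard (auto simp: less_eq_joinirr_def less_joinirr_def Rep_joinirr_inject less_le_not_le)

end

instance joinirr :: ("{finite, distrib_lattice}") finite
proof
  have "finite (Abs_joinirr ` {z :: 'a. join_irreducible z})"
    by simp
  then show "finite (UNIV :: 'a joinirr set)"
    by (simp add: type_definition.Abs_image[OF type_definition_joinirr])
qed

definition order_ideals :: "'p::order set set" where
  "order_ideals = {A. A \<noteq> {} \<and> (\<forall>x\<in>A. \<forall>y. y \<le> x \<longrightarrow> y \<in> A)}"

definition principal_ideal :: "'a::{finite, distrib_lattice} \<Rightarrow> 'a joinirr set" where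
  "principal_ideal \<alpha> = {\<theta>. Rep_joinirr \<theta> \<le> \<alpha>}"

section \<open>The Hibi toric variety\<close>

text \<open>Polynomials in the variables \<open>X\<^sub>\<alpha>\<close>, \<open>\<alpha> :: 'a\<close>, are finitely supported maps
  from monomials (exponent functions) to coefficients.\<close>

type_synonym ('a, 'k) mpoly = "('a \<Rightarrow>\<^sub>0 nat) \<Rightarrow>\<^sub>0 'k"

definition Var :: "'a \<Rightarrow> ('a, 'k::comm_ring_1) mpoly" where
  "Var \<alpha> = Poly_Mapping.single (Poly_Mapping.single \<alpha> 1) 1"

definition poly_eval :: "('a::finite, 'k::comm_ring_1) mpoly \<Rightarrow> 'k ^ 'a \<Rightarrow> 'k" where
  "poly_eval p x = (\<Sum>m\<in>Poly_Mapping.keys p.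
     Poly_Mapping.lookup p m * (\<Prod>\<alpha>\<in>UNIV. (x $ \<alpha>) ^ Poly_Mapping.lookup m \<alpha>))"

definition ideal_generated :: "'r::comm_ring_1 set \<Rightarrow> 'r set" where
  "ideal_generated G = {\<Sum>g\<in>F. c g * g | F c. finite F \<and> F \<subseteq> G}"

definition hibi_ideal :: "('a::{finite, distrib_lattice}, 'k::comm_ring_1) mpoly set" where
  "hibi_ideal = ideal_generated
     (range (\<lambda>(\<alpha>, \<beta>). Var \<alpha> * Var \<beta> - Var (sup \<alpha> \<beta>) * Var (inf \<alpha> \<beta>)))"

text \<open>A closed subset of affine space is the zero set of its vanishing ideal, so the
  variety with vanishing ideal \<open>hibi_ideal\<close> can only be the following set.\<close>

definition hibi_variety :: "('k::comm_ring_1 ^ 'a::{finite, distrib_lattice}) set" where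
  "hibi_variety = {x. \<forall>p\<in>hibi_ideal. poly_eval p x = 0}"

text \<open>The coordinate ring of a closed set \<open>X\<close>, realised as the ring of functions on \<open>X\<close>
  that are restrictions of polynomials (the polynomial ring modulo the vanishing ideal
  of \<open>X\<close>).\<close>

definition coordinate_ring :: "('k::comm_ring_1 ^ 'a::finite) set \<Rightarrow> ('k ^ 'a \<Rightarrow> 'k) set" where
  "coordinate_ring X = range (\<lambda>p. restrict (poly_eval p) X)"

section \<open>The torus and its characters\<close>

text \<open>The torus is \<open>(K\<^sup>*)\<^sup>J\<close> for a finite index type \<open>'j\<close>.  Its character group \<open>M\<close> is
  written additively as \<open>int ^ 'j\<close>, with \<open>axis z 1\<close> the coordinate character \<open>f\<^sub>z\<close>;
  the dual lattice \<open>N\<close> is \<open>int ^ 'j\<close> as well, in the dual basis, and the real scalar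
  extensions of \<open>M\<close> and \<open>N\<close> are \<open>real ^ 'j\<close>, paired by the inner product.\<close>

definition torus :: "('k::field ^ 'j::finite) set" where
  "torus = {t. \<forall>z. t $ z \<noteq> 0}"

definition character :: "int ^ 'j \<Rightarrow> 'k::field ^ 'j::finite \<Rightarrow> 'k" where
  "character m t = (\<Prod>z\<in>UNIV. (t $ z) powi (m $ z))"

definition ideal_char :: "'j::finite set \<Rightarrow> int ^ 'j" where
  "ideal_char A = (\<Sum>z\<in>A. axis z 1)"

text \<open>The semigroup algebra \<open>K[S]\<close> of a subset \<open>S\<close> of \<open>M\<close>, as functions on the torus;
  distinct characters are linearly independent, so no information is lost.\<close>

definition semigroup_algebra :: "(int ^ 'j::finite) set \<Rightarrow> ('k::field ^ 'j \<Rightarrow> 'k) set" where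
  "semigroup_algebra S =
     {restrict (\<lambda>t. \<Sum>m\<in>F. c m * character m t) torus | F c. finite F \<and> F \<subseteq> S}"

definition torus_embedding ::
    "'k::field ^ 'a joinirr \<Rightarrow> 'k ^ 'a::{finite, distrib_lattice}" where
  "torus_embedding t = (\<chi> \<alpha>. character (ideal_char (principal_ideal \<alpha>)) t)"

text \<open>The coordinate ring of the Hibi variety inside \<open>K[T] = K[M]\<close>: its elements are
  pulled back along the embedding of the torus.\<close>

definition hibi_coordinate_ring_in_KT ::
    "('k::field ^ 'a::{finite, distrib_lattice} joinirr \<Rightarrow> 'k) set" where
  "hibi_coordinate_ring_in_KT =
     {restrict (g \<circ> torus_embedding) torus | g. g \<in> coordinate_ring hibi_variety}"

section \<open>Cones\<close>

definition real_vec :: "int ^ 'j \<Rightarrow> real ^ 'j" where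
  "real_vec m = (\<chi> z. real_of_int (m $ z))"

definition rational_polyhedral_cone :: "(real ^ 'j::finite) set \<Rightarrow> bool" where
  "rational_polyhedral_cone \<sigma> \<longleftrightarrow>
     (\<exists>G :: (int ^ 'j) set. finite G \<and> \<sigma> = convex_cone hull (real_vec ` G))"

definition strongly_convex :: "(real ^ 'j::finite) set \<Rightarrow> bool" where
  "strongly_convex \<sigma> \<longleftrightarrow> \<sigma> \<inter> uminus ` \<sigma> = {0}"

definition dual_cone :: "(real ^ 'j::finite) set \<Rightarrow> (real ^ 'j) set" where
  "dual_cone \<sigma> = {u. \<forall>v\<in>\<sigma>. 0 \<le> u \<bullet> v}"

definition cone_semigroup :: "(real ^ 'j::finite) set \<Rightarrow> (int ^ 'j) set" where
  "cone_semigroup \<sigma> = {m. real_vec m \<in> dual_cone \<sigma>}"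

text \<open>\<open>hibi_cone TYPE('k) \<sigma>\<close>: \<open>\<sigma>\<close> is the cone of the affine toric variety
  \<open>hibi_variety\<close> over the field \<open>'k\<close>.  (It is generated by the vectors \<open>e\<^sub>z\<close> and
  \<open>e\<^sub>x - e\<^sub>y\<close>, \<open>x \<le> y\<close>.)\<close>

definition hibi_cone ::
    "'k::field itself \<Rightarrow> (real ^ 'a::{finite, distrib_lattice} joinirr) set \<Rightarrow> bool" where
  "hibi_cone _ \<sigma> \<longleftrightarrow>
     rational_polyhedral_cone \<sigma> \<and> strongly_convex \<sigma> \<and>
     (hibi_coordinate_ring_in_KT :: ('k ^ 'a joinirr \<Rightarrow> 'k) set)
       = semigroup_algebra (cone_semigroup \<sigma>)"

definition semigroup_generated :: "'m::monoid_add set \<Rightarrow> 'm set" where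
  "semigroup_generated G = {sum_list gs | gs. set gs \<subseteq> G}"

end

theory Submission
  imports Defs
begin

text \<open>
  By definition of the cone, \<open>K[X]\<close> and \<open>K[S\<^sub>\<sigma>]\<close> are the same ring of functions on the
  torus.  On the other hand \<open>K[X]\<close> is spanned by the pulled-back monomials, and the pullback
  of \<open>\<Prod>\<alpha>. X\<^sub>\<alpha> ^ m\<^sub>\<alpha>\<close> is the character \<open>\<Sum>\<alpha>. m\<^sub>\<alpha> f\<^sub>I\<close> with \<open>I = I\<^sub>\<alpha>\<close>.  Hence
  \<open>K[X] = K[S]\<close>, where \<open>S\<close> is the semigroup generated by the characters attached to the
  principal ideals (\<open>hibi_coordinate_ring_eq_semigroup_algebra\<close>).

  Over an infinite field distinct characters of a torus are distinct homomorphisms to the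
  multiplicative group, so by Artin's theorem they are linearly independent, and a set of
  characters can be recovered from its span (\<open>semigroup_algebra_subset_iff\<close>).  Thus
  \<open>S\<^sub>\<sigma> = S\<close>.  Birkhoff's representation theorem, \<open>\<alpha> \<mapsto> I\<^sub>\<alpha>\<close> being onto the nonempty order
  ideals (\<open>range_principal_ideal\<close>), puts the generators into the required form.
\<close>

section \<open>Birkhoff's theorem for the principal ideals\<close>

text \<open>By distributivity, \<open>z \<le> sup a b\<close> says that \<open>z\<close> is the join of \<open>inf z a\<close> and \<open>inf z b\<close>;
  so join-irreducible elements are join-prime.\<close>

lemma join_irreducible_le_sup_iff:
  fixes z :: "'a::distrib_lattice"
  assumes "join_irreducible z"
  shows "z \<le> sup a b \<longleftrightarrow> z \<le> a \<or> z \<le> b"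
proof
  assume "z \<le> sup a b"
  then have "z = sup (inf z a) (inf z b)"
    by (metis inf.absorb1 inf_sup_distrib1)
  then have "z = inf z a \<or> z = inf z b"
    using assms unfolding join_irreducible_def by blast
  then show "z \<le> a \<or> z \<le> b"
    by (metis inf.cobounded2)
qed (auto intro: le_supI1 le_supI2)

lemma join_irreducible_le_Sup_fin_iff:
  fixes z :: "'a::distrib_lattice"
  assumes "join_irreducible z" "finite B" "B \<noteq> {}"
  shows "z \<le> Sup_fin B \<longleftrightarrow> (\<exists>b\<in>B. z \<le> b)"
  using assms(2,3)
  by (induction B rule: finite_ne_induct) (simp_all add: join_irreducible_le_sup_iff[OF assms(1)])

lemma join_irreducible_Rep_joinirr: "join_irreducible (Rep_joinirr x)"
  using Rep_joinirr[of x] by simp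

lemma principal_ideal_sup: "principal_ideal (sup a b) = principal_ideal a \<union> principal_ideal b"
  by (auto simp: principal_ideal_def join_irreducible_le_sup_iff[OF join_irreducible_Rep_joinirr])

lemma principal_ideal_inf: "principal_ideal (inf a b) = principal_ideal a \<inter> principal_ideal b"
  by (auto simp: principal_ideal_def)

text \<open>The bottom element is join-irreducible, so every principal ideal is nonempty.\<close>

lemma principal_ideal_nonempty: "principal_ideal a \<noteq> {}"
proof -
  define b :: 'a where "b = Inf_fin UNIV"
  have b: "b \<le> x" for x
    by (simp add: b_def Inf_fin.coboundedI)
  have "join_irreducible b"
    unfolding join_irreducible_def by (metis b antisym sup_ge1)
  then have "Rep_joinirr (Abs_joinirr b) = b"
    by (simp add: Abs_joinirr_inverse)
  then have "Abs_joinirr b \<in> principal_ideal a"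
    by (simp add: principal_ideal_def b)
  then show ?thesis by blast
qed

text \<open>An order ideal is the principal ideal of the join of its elements, by join-primeness.\<close>

lemma range_principal_ideal:
  "range principal_ideal = (order_ideals :: 'a::{finite, distrib_lattice} joinirr set set)"
proof (intro equalityI subsetI)
  fix A :: "'a joinirr set"
  assume "A \<in> range principal_ideal"
  then show "A \<in> order_ideals"
    using principal_ideal_nonempty
    by (auto simp: order_ideals_def principal_ideal_def less_eq_joinirr_def intro: order_trans)
next
  fix A :: "'a joinirr set"
  assume "A \<in> order_ideals"
  then have A: "A \<noteq> {}" "\<And>x y. x \<in> A \<Longrightarrow> y \<le> x \<Longrightarrow> y \<in> A"
    by (auto simp: order_ideals_def)
  have "principal_ideal (Sup_fin (Rep_joinirr ` A)) = {y. \<exists>x\<in>A. y \<le> x}"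
    using A(1) by (auto simp: principal_ideal_def less_eq_joinirr_def
        join_irreducible_le_Sup_fin_iff[OF join_irreducible_Rep_joinirr])
  also have "\<dots> = A"
    using A(2) by blast
  finally show "A \<in> range principal_ideal"
    by blast
qed

section \<open>Characters of the torus\<close>

lemma character_0 [simp]: "character 0 t = 1"
  by (simp add: character_def)

lemma character_add:
  "t \<in> torus \<Longrightarrow> character (m + n) t = character m t * character n t"
  by (simp add: character_def torus_def power_int_add prod.distrib)

lemma character_sum:
  "t \<in> torus \<Longrightarrow> character (\<Sum>i\<in>A. m i) t = (\<Prod>i\<in>A. character (m i) t)"
  by (induction A rule: infinite_finite_induct) (simp_all add: character_add)

lemma character_mult: "character m (s * t) = character m s * character m t"
  by (simp add: character_def power_int_mult_distrib prod.distrib)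

lemma torus_mult: "s \<in> torus \<Longrightarrow> t \<in> torus \<Longrightarrow> s * t \<in> torus"
  by (simp add: torus_def)

lemma infinite_UNIV_alg_closed_field: "infinite (UNIV :: 'k::alg_closed_field set)"
proof
  assume fin: "finite (UNIV :: 'k set)"
  \<comment> \<open>A polynomial that takes the value 1 everywhere, yet is not constant.\<close>
  define q :: "'k poly" where "q = (\<Prod>a\<in>UNIV. [:- a, 1:])"
  have "degree q = (\<Sum>a\<in>(UNIV :: 'k set). degree [:- a, 1:])"
    unfolding q_def by (rule degree_prod_eq_sum_degree) simp
  then have "degree q = card (UNIV :: 'k set)"
    by simp
  then have "degree q > 0"
    using fin by (simp add: card_gt_0_iff)
  then have "degree (q + 1) > 0"
    by (simp add: degree_add_eq_left)
  then obtain x where "poly (q + 1) x = 0"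
    using alg_closed_imp_poly_has_root by blast
  moreover have "poly q x = 0"
    using fin by (auto simp: q_def poly_prod)
  ultimately show False by simp
qed

lemma exists_power_int_neq_1:
  fixes k :: int
  assumes "infinite (UNIV :: 'k::field set)" "k \<noteq> 0"
  shows "\<exists>a :: 'k. a \<noteq> 0 \<and> a powi k \<noteq> 1"
proof -
  define n where "n = nat \<bar>k\<bar>"
  have "n > 0"
    using assms(2) by (simp add: n_def)
  \<comment> \<open>The factor \<open>X\<close> also excludes zero.\<close>
  define p :: "'k poly" where "p = [:0, 1:] * (monom 1 n - 1)"
  have "coeff (monom 1 n - 1 :: 'k poly) n = 1"
    using \<open>n > 0\<close> by (simp add: coeff_1)
  then have "p \<noteq> 0"
    unfolding p_def by (metis coeff_0 mult_eq_0_iff one_neq_zero pCons_eq_0_iff)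
  then have "finite {x. poly p x = 0}"
    by (rule poly_roots_finite)
  then obtain a where a: "poly p a \<noteq> 0"
    using assms(1) by (metis (mono_tags) UNIV_eq_I mem_Collect_eq)
  have "a powi k \<noteq> 1"
  proof (cases "k \<ge> 0")
    case True
    with a show ?thesis by (auto simp: p_def n_def poly_monom power_int_def)
  next
    case False
    with a show ?thesis by (auto simp: p_def n_def poly_monom power_int_def power_inverse)
  qed
  with a show ?thesis by (auto simp: p_def)
qed

lemma exists_character_neq:
  fixes m n :: "int ^ 'j::finite"
  assumes "infinite (UNIV :: 'k::field set)" "m \<noteq> n"
  shows "\<exists>t\<in>torus. character m t \<noteq> (character n t :: 'k)"
proof -
  obtain z where z: "m $ z \<noteq> n $ z"
    using assms(2) by (auto simp: vec_eq_iff)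
  obtain a :: 'k where a: "a \<noteq> 0" "a powi (m $ z - n $ z) \<noteq> 1"
    using exists_power_int_neq_1[OF assms(1), of "m $ z - n $ z"] z by auto
  \<comment> \<open>A one-parameter subgroup in the direction of a coordinate that separates the two.\<close>
  define t :: "'k ^ 'j" where "t = (\<chi> i. if i = z then a else 1)"
  have "character u t = a powi (u $ z)" for u
  proof -
    have "character u t = (\<Prod>i\<in>UNIV. if i = z then a powi (u $ i) else 1)"
      unfolding character_def t_def by (intro prod.cong) auto
    then show ?thesis by simp
  qed
  moreover have "a powi (m $ z) \<noteq> a powi (n $ z)"
    using a by (auto simp: power_int_diff)
  moreover have "t \<in> torus"
    using a by (simp add: torus_def t_def)
  ultimately show ?thesis
    by (intro bexI[of _ t]) simp_all
qed

text \<open>Artin's argument: if a combination vanishes identically, comparing its values at \<open>s * t\<close>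
  with \<open>character m s\<close> times its values at \<open>t\<close> eliminates the character \<open>m\<close>.\<close>

lemma characters_linearly_independent:
  fixes c :: "int ^ 'j::finite \<Rightarrow> 'k::field"
  assumes "infinite (UNIV :: 'k set)" "finite F"
    and "\<And>t. t \<in> torus \<Longrightarrow> (\<Sum>m\<in>F. c m * character m t) = 0"
    and "m \<in> F"
  shows "c m = 0"
  using assms(2-4)
proof (induction F arbitrary: c m rule: finite_induct)
  case (insert u F)
  have eq: "(\<Sum>n\<in>F. c n * character n t) = - (c u * character u t)" if "t \<in> torus" for t
    using insert.prems(1)[OF that] insert.hyps by (simp add: eq_neg_iff_add_eq_0 add.commute)
  have F: "c n = 0" if "n \<in> F" for n
  proof -
    obtain s :: "'k ^ 'j" where s: "s \<in> torus" "character n s \<noteq> character u s"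
      using exists_character_neq[OF assms(1), of n u] insert.hyps \<open>n \<in> F\<close> by auto
    have "c n * (character n s - character u s) = 0"
    proof (rule insert.IH[OF _ \<open>n \<in> F\<close>, of "\<lambda>n. c n * (character n s - character u s)"])
      fix t :: "'k ^ 'j"
      assume t: "t \<in> torus"
      have "(\<Sum>n\<in>F. c n * (character n s - character u s) * character n t)
          = (\<Sum>n\<in>F. c n * character n (s * t)) - character u s * (\<Sum>n\<in>F. c n * character n t)"
        by (simp add: sum_distrib_left sum_subtractf[symmetric] character_mult algebra_simps)
      also have "\<dots> = - (c u * character u (s * t)) - character u s * - (c u * character u t)"
        by (simp only: eq[OF t] eq[OF torus_mult[OF s(1) t]])
      also have "\<dots> = 0"
        by (simp add: character_mult)
      finally show "(\<Sum>n\<in>F. c n * (character n s - character u s) * character n t) = 0" .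
    qed
    with s show ?thesis by simp
  qed
  moreover have "c u = 0"
    using eq[of 1] F by (simp add: torus_def character_def)
  ultimately show ?case
    using insert.prems(2) by auto
qed simp

text \<open>Expressing a character outside \<open>S'\<close> through characters in \<open>S'\<close> would be a nontrivial linear
  relation; hence a set of characters is determined by its span.\<close>

lemma semigroup_algebra_subset_iff:
  fixes S S' :: "(int ^ 'j::finite) set"
  assumes "infinite (UNIV :: 'k::field set)"
  shows "(semigroup_algebra S :: ('k ^ 'j \<Rightarrow> 'k) set) \<subseteq> semigroup_algebra S' \<longleftrightarrow> S \<subseteq> S'"
proof
  assume sub: "(semigroup_algebra S :: ('k ^ 'j \<Rightarrow> 'k) set) \<subseteq> semigroup_algebra S'"
  show "S \<subseteq> S'"
  proof
    fix m
    assume "m \<in> S"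
    have "restrict (\<lambda>t. \<Sum>n\<in>{m}. 1 * character n t) torus \<in> (semigroup_algebra S :: ('k ^ 'j \<Rightarrow> 'k) set)"
      using \<open>m \<in> S\<close> unfolding semigroup_algebra_def
      by (intro CollectI exI[of _ "{m}"] exI[of _ "\<lambda>_. 1"]) auto
    then have "restrict (\<lambda>t. \<Sum>n\<in>{m}. 1 * character n t) torus \<in> (semigroup_algebra S' :: ('k ^ 'j \<Rightarrow> 'k) set)"
      using sub by (rule rev_subsetD)
    then obtain F and c :: "int ^ 'j \<Rightarrow> 'k" where
      eq: "restrict (\<lambda>t. \<Sum>n\<in>{m}. 1 * character n t) torus
         = restrict (\<lambda>t. \<Sum>n\<in>F. c n * character n t) torus"
      and F: "finite F" "F \<subseteq> S'"
      unfolding semigroup_algebra_def mem_Collect_eq by (elim exE conjE) (rule that)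
    have char_m: "character m t = (\<Sum>n\<in>F. c n * character n t)" if "t \<in> torus" for t
      using fun_cong[OF eq, of t] that by simp
    show "m \<in> S'"
    proof (rule ccontr)
      assume "m \<notin> S'"
      then have "m \<notin> F" using F by blast
      define d where "d n = (if n = m then - 1 else c n)" for n
      have "(\<Sum>n\<in>insert m F. d n * character n t) = 0" if "t \<in> torus" for t
      proof -
        have "(\<Sum>n\<in>F. d n * character n t) = (\<Sum>n\<in>F. c n * character n t)"
          using \<open>m \<notin> F\<close> by (intro sum.cong) (auto simp: d_def)
        then show ?thesis
          using \<open>m \<notin> F\<close> F char_m[OF that] by (simp add: d_def)
      qed
      then have "d m = 0"
        using characters_linearly_independent[OF assms, of "insert m F" d m] F by simp
      then show False by (simp add: d_def)
    qed
  qed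
next
  assume "S \<subseteq> S'"
  then show "(semigroup_algebra S :: ('k ^ 'j \<Rightarrow> 'k) set) \<subseteq> semigroup_algebra S'"
    unfolding semigroup_algebra_def by blast
qed

section \<open>Evaluation of polynomials\<close>

lemma poly_eval_superset:
  assumes "finite A" "Poly_Mapping.keys p \<subseteq> A"
  shows "poly_eval p x = (\<Sum>m\<in>A. Poly_Mapping.lookup p m *
           (\<Prod>\<alpha>\<in>UNIV. (x $ \<alpha>) ^ Poly_Mapping.lookup m \<alpha>))"
  unfolding poly_eval_def using assms
  by (intro sum.mono_neutral_left) (auto simp: in_keys_iff)

lemma poly_eval_0 [simp]: "poly_eval 0 x = 0"
  by (simp add: poly_eval_def)

lemma poly_eval_add: "poly_eval (p + q) x = poly_eval p x + poly_eval q x"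
proof -
  let ?A = "Poly_Mapping.keys p \<union> Poly_Mapping.keys q"
  have "Poly_Mapping.keys (p + q) \<subseteq> ?A"
    by (rule keys_add)
  then show ?thesis
    by (simp add: poly_eval_superset[of ?A] lookup_add sum.distrib distrib_right)
qed

lemma poly_eval_diff: "poly_eval (p - q) x = poly_eval p x - poly_eval q x"
  using poly_eval_add[of "p - q" q x] by simp

lemma poly_eval_sum: "poly_eval (\<Sum>i\<in>A. p i) x = (\<Sum>i\<in>A. poly_eval (p i) x)"
  by (induction A rule: infinite_finite_induct) (simp_all add: poly_eval_add)

lemma poly_eval_single:
  "poly_eval (Poly_Mapping.single m a) x = a * (\<Prod>\<alpha>\<in>UNIV. (x $ \<alpha>) ^ Poly_Mapping.lookup m \<alpha>)"
  by (simp add: poly_eval_superset[of "{m}"])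

lemma poly_mapping_eq_sum_single:
  "p = (\<Sum>m\<in>Poly_Mapping.keys p. Poly_Mapping.single m (Poly_Mapping.lookup p m))"
  by (rule poly_mapping_eqI)
    (auto simp: lookup_sum lookup_single when_def in_keys_iff)

lemma poly_eval_mult: "poly_eval (p * q) x = poly_eval p x * poly_eval q x"
proof -
  let ?s = "\<lambda>p m. Poly_Mapping.single m (Poly_Mapping.lookup p m)"
  let ?P = "Poly_Mapping.keys p" and ?Q = "Poly_Mapping.keys q"
  have single: "poly_eval (?s p m * ?s q n) x = poly_eval (?s p m) x * poly_eval (?s q n) x" for m n
    by (simp add: mult_single poly_eval_single lookup_add power_add prod.distrib)
  have "poly_eval (p * q) x = poly_eval ((\<Sum>m\<in>?P. ?s p m) * (\<Sum>n\<in>?Q. ?s q n)) x"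
    by (simp flip: poly_mapping_eq_sum_single)
  also have "\<dots> = (\<Sum>m\<in>?P. poly_eval (?s p m) x) * (\<Sum>n\<in>?Q. poly_eval (?s q n) x)"
    by (simp add: sum_product poly_eval_sum single)
  also have "\<dots> = poly_eval p x * poly_eval q x"
    by (simp flip: poly_eval_sum poly_mapping_eq_sum_single)
  finally show ?thesis .
qed

lemma poly_eval_Var: "poly_eval (Var \<alpha>) x = x $ \<alpha>"
proof -
  have "(\<Prod>\<beta>\<in>UNIV. (x $ \<beta>) ^ Poly_Mapping.lookup (Poly_Mapping.single \<alpha> 1) \<beta>)
      = (\<Prod>\<beta>\<in>UNIV. if \<beta> = \<alpha> then x $ \<beta> else 1)"
    by (intro prod.cong) (auto simp: lookup_single)
  then show ?thesis
    by (simp add: Var_def poly_eval_single)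
qed

section \<open>The semigroup of the Hibi variety\<close>

lemma ideal_char_nth: "ideal_char A $ z = (if z \<in> A then 1 else 0)"
  by (simp add: ideal_char_def axis_def)

text \<open>The Hibi relations hold on the torus because join and meet in the lattice become union and
  intersection of ideals.\<close>

lemma torus_embedding_in_hibi_variety:
  fixes t :: "'k::field ^ 'a::{finite, distrib_lattice} joinirr"
  assumes "t \<in> torus"
  shows "torus_embedding t \<in> hibi_variety"
proof -
  have rel: "torus_embedding t $ \<alpha> * torus_embedding t $ \<beta>
      = torus_embedding t $ (sup \<alpha> \<beta>) * torus_embedding t $ (inf \<alpha> \<beta>)" for \<alpha> \<beta>
  proof -
    have "ideal_char (principal_ideal \<alpha>) + ideal_char (principal_ideal \<beta>)
        = ideal_char (principal_ideal (sup \<alpha> \<beta>)) + ideal_char (principal_ideal (inf \<alpha> \<beta>))"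
      by (auto simp: vec_eq_iff ideal_char_nth principal_ideal_sup principal_ideal_inf)
    then show ?thesis
      by (simp add: torus_embedding_def character_add[OF assms, symmetric])
  qed
  let ?G = "range (\<lambda>(\<alpha>, \<beta>). Var \<alpha> * Var \<beta> - Var (sup \<alpha> \<beta>) * Var (inf \<alpha> \<beta>)) :: ('a, 'k) mpoly set"
  have gen: "poly_eval g (torus_embedding t) = 0" if "g \<in> ?G" for g
    using that by (auto simp: poly_eval_diff poly_eval_mult poly_eval_Var rel[symmetric])
  have "poly_eval p (torus_embedding t) = 0" if p_in: "p \<in> hibi_ideal" for p
  proof -
    obtain F c where p: "p = (\<Sum>g\<in>F. c g * g)" and "finite F" and F: "F \<subseteq> ?G"
      using p_in unfolding hibi_ideal_def ideal_generated_def mem_Collect_eq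
      by (elim exE conjE) (rule that)
    show ?thesis
      unfolding p poly_eval_sum poly_eval_mult
      by (intro sum.neutral ballI) (simp add: gen[OF subsetD[OF F]])
  qed
  then show ?thesis
    by (simp add: hibi_variety_def)
qed

lemma hibi_coordinate_ring_in_KT_eq:
  "(hibi_coordinate_ring_in_KT :: ('k::field ^ 'a::{finite, distrib_lattice} joinirr \<Rightarrow> 'k) set)
     = range (\<lambda>p. restrict (\<lambda>t. poly_eval p (torus_embedding t)) torus)"
proof -
  have "restrict (restrict (poly_eval p) hibi_variety \<circ> torus_embedding) torus
      = restrict (\<lambda>t :: 'k ^ 'a joinirr. poly_eval p (torus_embedding t)) torus" for p
    by (auto simp: restrict_def fun_eq_iff torus_embedding_in_hibi_variety)
  then show ?thesis
    unfolding hibi_coordinate_ring_in_KT_def coordinate_ring_def image_def by auto metis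
qed

text \<open>The character to which the monomial with exponents \<open>m\<close> pulls back.  The inner sum stands
  for the multiple of an integer vector by a natural number.\<close>

definition monomial_char :: "('a::{finite, distrib_lattice} \<Rightarrow>\<^sub>0 nat) \<Rightarrow> int ^ 'a joinirr" where
  "monomial_char m =
     (\<Sum>\<alpha>\<in>UNIV. \<Sum>i<Poly_Mapping.lookup m \<alpha>. ideal_char (principal_ideal \<alpha>))"

lemma character_monomial_char:
  "t \<in> torus \<Longrightarrow> character (monomial_char m) t
     = (\<Prod>\<alpha>\<in>UNIV. (torus_embedding t $ \<alpha>) ^ Poly_Mapping.lookup m \<alpha>)"
  by (simp add: monomial_char_def torus_embedding_def character_sum del: sum_constant)

lemma semigroup_generated_0: "0 \<in> semigroup_generated G"
  unfolding semigroup_generated_def by (auto intro!: exI[of _ "[]"])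

lemma semigroup_generated_base: "g \<in> G \<Longrightarrow> g \<in> semigroup_generated G"
  unfolding semigroup_generated_def by (auto intro!: exI[of _ "[g]"])

lemma semigroup_generated_add:
  "a \<in> semigroup_generated G \<Longrightarrow> b \<in> semigroup_generated G \<Longrightarrow> a + b \<in> semigroup_generated G"
  unfolding semigroup_generated_def
  by clarsimp (metis le_sup_iff set_append sum_list_append)

lemma semigroup_generated_sum:
  fixes f :: "'i \<Rightarrow> 'm::comm_monoid_add"
  shows "(\<And>i. i \<in> A \<Longrightarrow> f i \<in> semigroup_generated G) \<Longrightarrow> (\<Sum>i\<in>A. f i) \<in> semigroup_generated G"
  by (induction A rule: infinite_finite_induct)
    (auto intro: semigroup_generated_0 semigroup_generated_add)

lemma range_monomial_char:
  "range monomial_char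
     = semigroup_generated (range (\<lambda>\<alpha> :: 'a::{finite, distrib_lattice}. ideal_char (principal_ideal \<alpha>)))"
  (is "_ = semigroup_generated ?G")
proof (intro equalityI subsetI)
  fix u :: "int ^ 'a joinirr"
  assume "u \<in> range monomial_char"
  then obtain m where "u = monomial_char m" by blast
  then show "u \<in> semigroup_generated ?G"
    unfolding monomial_char_def
    by (simp del: sum_constant add: semigroup_generated_sum semigroup_generated_base)
next
  fix u :: "int ^ 'a joinirr"
  assume "u \<in> semigroup_generated ?G"
  then obtain gs where gs: "u = sum_list gs" "set gs \<subseteq> ?G"
    unfolding semigroup_generated_def mem_Collect_eq by (elim exE conjE) (rule that)
  have "sum_list gs \<in> range monomial_char"
    using gs(2)
  proof (induction gs)
    case Nil
    have "monomial_char (0 :: 'a \<Rightarrow>\<^sub>0 nat) = 0"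
      by (simp add: monomial_char_def)
    then show ?case by (metis rangeI sum_list.Nil)
  next
    case (Cons g gs)
    then obtain m \<alpha> where m: "sum_list gs = monomial_char m" and g: "g = ideal_char (principal_ideal \<alpha>)"
      by auto
    have "(\<Sum>i<Poly_Mapping.lookup (Poly_Mapping.single \<alpha> 1 + m) \<beta>. ideal_char (principal_ideal \<beta>))
        = (if \<beta> = \<alpha> then g else 0)
          + (\<Sum>i<Poly_Mapping.lookup m \<beta>. ideal_char (principal_ideal \<beta>))" for \<beta>
      by (simp add: lookup_add lookup_single g when_def add.commute del: sum_constant)
    then have "monomial_char (Poly_Mapping.single \<alpha> 1 + m) = g + monomial_char m"
      by (simp add: monomial_char_def sum.distrib del: sum_constant)
    then show ?case
      by (metis m rangeI sum_list.Cons)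
  qed
  then show "u \<in> range monomial_char" by (simp add: gs)
qed

theorem hibi_coordinate_ring_eq_semigroup_algebra:
  "(hibi_coordinate_ring_in_KT :: ('k::field ^ 'a::{finite, distrib_lattice} joinirr \<Rightarrow> 'k) set)
     = semigroup_algebra (semigroup_generated (range (\<lambda>\<alpha>. ideal_char (principal_ideal \<alpha>))))"
proof -
  \<comment> \<open>Several monomials may pull back to the same character; their coefficients add up.\<close>
  have "restrict (\<lambda>t. poly_eval p (torus_embedding t)) torus
      \<in> (semigroup_algebra (range monomial_char) :: ('k ^ 'a joinirr \<Rightarrow> 'k) set)" for p
  proof -
    let ?K = "Poly_Mapping.keys p"
    define c where "c u = (\<Sum>m\<in>{m \<in> ?K. monomial_char m = u}. Poly_Mapping.lookup p m)" for u
    have "poly_eval p (torus_embedding t) = (\<Sum>u\<in>monomial_char ` ?K. c u * character u t)"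
      if "t \<in> torus" for t
    proof -
      have "poly_eval p (torus_embedding t)
          = (\<Sum>m\<in>?K. Poly_Mapping.lookup p m * character (monomial_char m) t)"
        by (simp add: poly_eval_def character_monomial_char[OF that])
      also have "\<dots> = (\<Sum>u\<in>monomial_char ` ?K. \<Sum>m\<in>{m \<in> ?K. monomial_char m = u}.
                        Poly_Mapping.lookup p m * character (monomial_char m) t)"
        by (rule sum.image_gen) simp
      also have "\<dots> = (\<Sum>u\<in>monomial_char ` ?K. c u * character u t)"
        unfolding c_def sum_distrib_right by (intro sum.cong) auto
      finally show ?thesis .
    qed
    then have "restrict (\<lambda>t. poly_eval p (torus_embedding t)) torus
        = restrict (\<lambda>t. \<Sum>u\<in>monomial_char ` ?K. c u * character u t) torus"
      by (rule restrict_ext)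
    then show ?thesis
      unfolding semigroup_algebra_def
      by (intro CollectI exI[of _ "monomial_char ` ?K"] exI[of _ c]) auto
  qed
  moreover have "restrict (\<lambda>t. \<Sum>u\<in>F. c u * character u t) torus \<in> hibi_coordinate_ring_in_KT"
    if "F \<subseteq> range monomial_char" for F and c :: "int ^ 'a joinirr \<Rightarrow> 'k"
  proof -
    define mon where "mon u = (SOME m. monomial_char m = u)" for u :: "int ^ 'a joinirr"
    have mon: "monomial_char (mon u) = u" if "u \<in> F" for u
    proof -
      obtain m where "monomial_char m = u"
        using \<open>F \<subseteq> range monomial_char\<close> \<open>u \<in> F\<close> by blast
      then show ?thesis
        unfolding mon_def by (rule someI)
    qed
    define p where "p = (\<Sum>u\<in>F. Poly_Mapping.single (mon u) (c u))"
    have "poly_eval p (torus_embedding t) = (\<Sum>u\<in>F. c u * character u t)" if "t \<in> torus" for t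
      unfolding p_def poly_eval_sum
      by (intro sum.cong) (simp_all add: poly_eval_single character_monomial_char[OF that, symmetric] mon)
    then have "restrict (\<lambda>t. \<Sum>u\<in>F. c u * character u t) torus
        = restrict (\<lambda>t. poly_eval p (torus_embedding t)) torus"
      by (intro restrict_ext) simp
    then show ?thesis
      unfolding hibi_coordinate_ring_in_KT_eq by blast
  qed
  ultimately have "hibi_coordinate_ring_in_KT
      = (semigroup_algebra (range monomial_char) :: ('k ^ 'a joinirr \<Rightarrow> 'k) set)"
    unfolding hibi_coordinate_ring_in_KT_eq by (auto simp: semigroup_algebra_def)
  then show ?thesis
    by (simp add: range_monomial_char)
qed

theorem proposition4p6:
  fixes \<sigma> :: "(real ^ 'a::{finite, distrib_lattice} joinirr) set"
  assumes "hibi_cone TYPE('k::alg_closed_field) \<sigma>"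
  shows "cone_semigroup \<sigma> =
    semigroup_generated {ideal_char A | A. A \<in> (order_ideals :: 'a joinirr set set)}"
proof -
  let ?S = "semigroup_generated (range (\<lambda>\<alpha> :: 'a. ideal_char (principal_ideal \<alpha>)))"
  have "(semigroup_algebra (cone_semigroup \<sigma>) :: ('k ^ 'a joinirr \<Rightarrow> 'k) set) = semigroup_algebra ?S"
    using assms by (simp add: hibi_cone_def hibi_coordinate_ring_eq_semigroup_algebra)
  then have "cone_semigroup \<sigma> = ?S"
    using semigroup_algebra_subset_iff[OF infinite_UNIV_alg_closed_field[where 'k = 'k]]
    by (metis order_antisym order_refl)
  also have "range (\<lambda>\<alpha> :: 'a. ideal_char (principal_ideal \<alpha>)) = ideal_char ` range principal_ideal"
    by (rule image_image[symmetric])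
  also have "\<dots> = {ideal_char A | A. A \<in> (order_ideals :: 'a joinirr set set)}"
    by (auto simp: range_principal_ideal)
  finally show ?thesis .
qed

end
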